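(* Let $n\ge1$ be an integer, $a<b$ real numbers, $0<\alpha<1$ and $x\in{}_{c}AC^\alpha_{a+}$. If there exist two real numbers $a\le c<d\le b$ such that (i) $x(t)=0_{\mathbb{R}^n}$ for all $t\in[c,d]$; (ii) ${}_{c}D^\alpha_{a+}[x](t)=0_{\mathbb{R}^n}$ for almost every $t\in[c,d]$; then $x(t)=0_{\mathbb{R}^n}$ for all $t\in[a,d]$.
   Context: Functions are defined on $[a,b]$ with values in $\mathbb{R}^n$; $C$ denotes continuous functions and $AC$ absolutely continuous ones. For $\gamma>0$ and $f\in L^1$, $I^\gamma_{a+}[f](t):=\int_a^t\frac{(t-s)^{\gamma-1}}{\Gamma(\gamma)}f(s)\,ds$ for a.e. $t\in[a,b]$ (identified with its continuous representative if it has one). The space $AC^\alpha_{a+}$ is the set of $f\in L^1$ with $I^{1-\alpha}_{a+}[f]\in AC$, and then $D^\alpha_{a+}[f]:=\frac{d}{dt}I^{1-\alpha}_{a+}[f]$ a.e. The space ${}_{c}AC^\alpha_{a+}$ is the set of $x\in C$ with $x-x(a)\in AC^\alpha_{a+}$, and the left Caputo fractional derivative of such $x$ is ${}_{c}D^\alpha_{a+}[x]:=D^\alpha_{a+}[x-x(a)]\in L^1$. *)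

theory Defs
  imports "HOL-Analysis.Analysis"
begin

text \<open>
  Functions on \<open>[a, b]\<close> are represented by total functions on \<^typ>\<open>real\<close>; none of the
  notions below depends on values outside \<open>[a, b]\<close>. The space \<open>L\<^sup>1\<close> is rendered by
  absolute (i.e. Lebesgue) integrability on \<open>{a..b}\<close>, its elements being functions rather
  than classes modulo equality almost everywhere.
\<close>

definition AC :: "real \<Rightarrow> real \<Rightarrow> (real \<Rightarrow> 'a::euclidean_space) set" where
  "AC a b = {f. \<forall>\<epsilon>>0. \<exists>\<delta>>0. \<forall>P :: (real \<times> real) set.
      finite P \<longrightarrow> (\<forall>(u, v)\<in>P. a \<le> u \<and> u \<le> v \<and> v \<le> b) \<longrightarrow>
      pairwise (\<lambda>p q. disjnt {fst p<..<snd p} {fst q<..<snd q}) P \<longrightarrow>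
      (\<Sum>(u, v)\<in>P. v - u) < \<delta> \<longrightarrow> (\<Sum>(u, v)\<in>P. norm (f v - f u)) < \<epsilon>}"

text \<open>
  The pointwise formula for the Riemann--Liouville integral. For \<open>f\<close> in \<open>L\<^sup>1\<close> the integral
  exists for almost every \<open>t\<close>; at the remaining \<open>t\<close> the value is the default 0.
\<close>

definition RL_kernel_integral ::
    "real \<Rightarrow> real \<Rightarrow> (real \<Rightarrow> 'a::euclidean_space) \<Rightarrow> real \<Rightarrow> 'a" where
  "RL_kernel_integral \<gamma> a f t =
     (LINT s:{a..t}|lebesgue. ((t - s) powr (\<gamma> - 1) / Gamma \<gamma>) *\<^sub>R f s)"

definition is_cont_rep ::
    "real \<Rightarrow> real \<Rightarrow> (real \<Rightarrow> 'a::euclidean_space) \<Rightarrow> (real \<Rightarrow> 'a) \<Rightarrow> bool" where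
  "is_cont_rep a b f g \<longleftrightarrow>
     continuous_on {a..b} g \<and> (AE t\<in>{a..b} in lebesgue. g t = f t)"

text \<open>
  Two continuous representatives coincide on \<open>{a..b}\<close> when \<open>a < b\<close>, so the choice below
  is immaterial.
\<close>

definition RL_integral ::
    "real \<Rightarrow> real \<Rightarrow> real \<Rightarrow> (real \<Rightarrow> 'a::euclidean_space) \<Rightarrow> real \<Rightarrow> 'a" where
  "RL_integral \<gamma> a b f =
     (if \<exists>g. is_cont_rep a b (RL_kernel_integral \<gamma> a f) g
      then SOME g. is_cont_rep a b (RL_kernel_integral \<gamma> a f) g
      else RL_kernel_integral \<gamma> a f)"

definition RL_AC :: "real \<Rightarrow> real \<Rightarrow> real \<Rightarrow> (real \<Rightarrow> 'a::euclidean_space) set" where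
  "RL_AC \<alpha> a b = {f. f absolutely_integrable_on {a..b} \<and> RL_integral (1 - \<alpha>) a b f \<in> AC a b}"

text \<open>
  The derivative of a function in \<open>AC\<close> exists almost everywhere; on the remaining null set
  the value below is unspecified, so it is meaningful only up to equality almost everywhere.
\<close>

definition RL_deriv ::
    "real \<Rightarrow> real \<Rightarrow> real \<Rightarrow> (real \<Rightarrow> 'a::euclidean_space) \<Rightarrow> real \<Rightarrow> 'a" where
  "RL_deriv \<alpha> a b f t = vector_derivative (RL_integral (1 - \<alpha>) a b f) (at t within {a..b})"

definition Caputo_AC :: "real \<Rightarrow> real \<Rightarrow> real \<Rightarrow> (real \<Rightarrow> 'a::euclidean_space) set" where
  "Caputo_AC \<alpha> a b = {x. continuous_on {a..b} x \<and> (\<lambda>t. x t - x a) \<in> RL_AC \<alpha> a b}"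

definition Caputo_deriv ::
    "real \<Rightarrow> real \<Rightarrow> real \<Rightarrow> (real \<Rightarrow> 'a::euclidean_space) \<Rightarrow> real \<Rightarrow> 'a" where
  "Caputo_deriv \<alpha> a b x = RL_deriv \<alpha> a b (\<lambda>t. x t - x a)"

end

theory Submission
  imports Defs
begin

text \<open>
  The Caputo derivative of \<open>x\<close> sees the whole past of \<open>x\<close>, and on an interval \<open>(c, d)\<close> where
  \<open>x\<close> vanishes it sees nothing else. Let \<open>y\<close> be the extension of \<open>x\<close> to \<open>(-\<infinity>, c]\<close> by the
  constant \<open>x(a)\<close> on \<open>(-\<infinity>, a]\<close>. For \<open>t\<close> in \<open>(c, d)\<close> the Caputo derivative is, up to the factor
  \<open>-1 / \<Gamma>(1 - \<alpha>)\<close>, the value at \<open>\<beta> = \<alpha>\<close> of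
  \<open>E\<^sub>\<beta>(t) = \<beta> \<integral> (t - s)\<^bsup>-\<beta>-1\<^esup> y(s) ds\<close>, the integral being over \<open>s \<le> c\<close>,
  since subtracting \<open>x(a)\<close> in front of the kernel amounts to this extension
  (lemma \<open>Caputo_deriv_eq_history\<close>). The kernel has no singularity for \<open>t > c\<close>, so \<open>E\<^sub>\<alpha>\<close> is
  smooth there; vanishing almost everywhere on \<open>(c, d)\<close>, it vanishes everywhere on \<open>(c, d)\<close>.

  Because the derivative of \<open>E\<^sub>\<beta>\<close> is \<open>-\<beta> E\<^bsub>\<beta>+1\<^esub>\<close>, all \<open>E\<^bsub>\<alpha>+k\<^esub>\<close> then vanish on
  \<open>(c, d)\<close>. Fix one \<open>t\<close> in this interval and substitute \<open>u = 1 / (t - s)\<close>, which maps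
  \<open>(-\<infinity>, c]\<close> to the bounded interval \<open>(0, 1 / (t - c)]\<close>: the conditions become
  \<open>\<integral> y(t - 1 / u) u\<^bsup>\<alpha>+k-1\<^esup> du = 0\<close> over this interval for all \<open>k\<close>. For \<open>k \<ge> 1\<close> they say that
  all moments of the function \<open>y(t - 1 / u) u\<^sup>\<alpha>\<close>, continuous up to \<open>u = 0\<close>, vanish. By the Weierstrass
  approximation theorem this function is zero (lemma \<open>history_vanishes_imp_zero\<close>), hence so
  is \<open>x\<close> on \<open>[a, c]\<close>.
\<close>

section \<open>The history integral\<close>

text \<open>
  For \<open>\<beta> > 0\<close> and \<open>t > c\<close> this is \<open>\<beta>\<close> times the integral of \<open>(t - s) powr (- \<beta> - 1) *\<^sub>R y s\<close> over
  \<open>s \<le> c\<close>, where \<open>y\<close> is \<open>x\<close> extended by the constant \<open>x a\<close> to the left of \<open>a\<close>; the last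
  summand is the contribution of \<open>s \<le> a\<close>. The closed form also makes sense for the negative
  order \<open>\<beta> = \<alpha> - 1\<close>, where the improper integral diverges unless \<open>x a = 0\<close>; this order
  describes the Riemann--Liouville integral.
\<close>

definition history :: "(real \<Rightarrow> 'a::euclidean_space) \<Rightarrow> real \<Rightarrow> real \<Rightarrow> real \<Rightarrow> real \<Rightarrow> 'a" where
  "history x a c \<beta> t =
     \<beta> *\<^sub>R integral {a..c} (\<lambda>s. (t - s) powr (- \<beta> - 1) *\<^sub>R x s) + (t - a) powr (- \<beta>) *\<^sub>R x a"

text \<open>
  Both summands of the history integral are differentiated with respect to \<open>t\<close>; the prefactor
  \<open>\<beta>\<close> is what makes them combine to a history integral of order \<open>\<beta> + 1\<close>.
\<close>

lemma has_vector_derivative_history: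
  fixes x :: "real \<Rightarrow> 'a::euclidean_space"
  assumes x: "continuous_on {a..c} x" and "a \<le> c" "c < t"
  shows "(history x a c \<beta> has_vector_derivative - \<beta> *\<^sub>R history x a c (\<beta> + 1) t) (at t)"
proof -
  have *: "((\<lambda>t. integral (cbox a c) (\<lambda>s. (t - s) powr (- \<beta> - 1) *\<^sub>R x s)) has_vector_derivative
      integral (cbox a c) (\<lambda>s. ((- \<beta> - 1) * (t - s) powr (- \<beta> - 2)) *\<^sub>R x s)) (at t within {c<..})"
  proof (rule leibniz_rule_vector_derivative)
    fix t s assume "t \<in> {c<..}" "s \<in> cbox a c"
    then have "((\<lambda>t. (t - s) powr (- \<beta> - 1)) has_real_derivative
        (- \<beta> - 1) * (t - s) powr (- \<beta> - 2)) (at t within {c<..})"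
      by (auto intro!: derivative_eq_intros simp: algebra_simps)
    from has_vector_derivative_scaleR[OF this has_vector_derivative_const[of "x s"]]
    show "((\<lambda>t. (t - s) powr (- \<beta> - 1) *\<^sub>R x s) has_vector_derivative
        ((- \<beta> - 1) * (t - s) powr (- \<beta> - 2)) *\<^sub>R x s) (at t within {c<..})"
      by simp
  next
    fix t assume "t \<in> {c<..}"
    then show "(\<lambda>s. (t - s) powr (- \<beta> - 1) *\<^sub>R x s) integrable_on cbox a c"
      using x by (intro integrable_continuous continuous_intros) auto
  next
    have "continuous_on ({c<..} \<times> cbox a c) (\<lambda>p. x (snd p))"
      by (rule continuous_on_compose2[OF x]) (auto intro!: continuous_intros)
    then show "continuous_on ({c<..} \<times> cbox a c)
        (\<lambda>(t, s). ((- \<beta> - 1) * (t - s) powr (- \<beta> - 2)) *\<^sub>R x s)"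
      by (auto simp: split_beta intro!: continuous_intros)
  qed (use assms in auto)
  have int: "integral (cbox a c) (\<lambda>s. ((- \<beta> - 1) * (t - s) powr (- \<beta> - 2)) *\<^sub>R x s)
      = (- \<beta> - 1) *\<^sub>R integral {a..c} (\<lambda>s. (t - s) powr (- \<beta> - 2) *\<^sub>R x s)"
    by (simp flip: scaleR_scaleR)
  have I: "((\<lambda>t. integral {a..c} (\<lambda>s. (t - s) powr (- \<beta> - 1) *\<^sub>R x s)) has_vector_derivative
      (- \<beta> - 1) *\<^sub>R integral {a..c} (\<lambda>s. (t - s) powr (- \<beta> - 2) *\<^sub>R x s)) (at t)"
    using * at_within_open[of t "{c<..}"] \<open>c < t\<close>
    unfolding int unfolding box_real by (simp only: greaterThan_iff open_greaterThan)
  have "((\<lambda>t. (t - a) powr (- \<beta>)) has_real_derivative - \<beta> * (t - a) powr (- \<beta> - 1)) (at t)"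
    using assms by (auto intro!: derivative_eq_intros)
  from has_vector_derivative_scaleR[OF this has_vector_derivative_const[of "x a"]]
  have B: "((\<lambda>t. (t - a) powr (- \<beta>) *\<^sub>R x a) has_vector_derivative
      (- \<beta> * (t - a) powr (- \<beta> - 1)) *\<^sub>R x a) (at t)"
    by simp
  have orders: "- (\<beta> + 1) = - \<beta> - 1" "- \<beta> - 1 - 1 = - \<beta> - 2" by simp_all
  have "((\<lambda>t. \<beta> *\<^sub>R integral {a..c} (\<lambda>s. (t - s) powr (- \<beta> - 1) *\<^sub>R x s)
        + (t - a) powr (- \<beta>) *\<^sub>R x a) has_vector_derivative
      \<beta> *\<^sub>R (- \<beta> - 1) *\<^sub>R integral {a..c} (\<lambda>s. (t - s) powr (- \<beta> - 2) *\<^sub>R x s)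
        + (- \<beta> * (t - a) powr (- \<beta> - 1)) *\<^sub>R x a) (at t)"
    using has_vector_derivative_add[OF
        bounded_linear.has_vector_derivative[OF bounded_linear_scaleR_right I] B] .
  then show ?thesis
    unfolding history_def[abs_def] orders by (simp add: algebra_simps)
qed

lemma continuous_on_history:
  assumes "continuous_on {a..c} x" "a \<le> c"
  shows "continuous_on {c<..} (history x a c \<beta>)"
  using has_vector_derivative_history[OF assms]
  by (intro continuous_at_imp_continuous_on) (auto intro: has_vector_derivative_continuous)

lemma history_vanishes_higher_order:
  assumes x: "continuous_on {a..c} x" "a \<le> c" and "\<beta> > 0"
    and 0: "\<And>t. t \<in> {c<..<d} \<Longrightarrow> history x a c \<beta> t = 0"
  shows "t \<in> {c<..<d} \<Longrightarrow> history x a c (\<beta> + real k) t = 0"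
proof (induction k arbitrary: t)
  case (Suc k)
  have "(history x a c (\<beta> + k) has_vector_derivative
      - (\<beta> + k) *\<^sub>R history x a c (\<beta> + k + 1) t) (at t)"
    using Suc.prems by (intro has_vector_derivative_history x) simp
  moreover have "(history x a c (\<beta> + k) has_vector_derivative 0) (at t)"
    by (rule has_vector_derivative_transform_within_open[of "\<lambda>_. 0" _ _ "{c<..<d}"])
      (use Suc in auto)
  ultimately have "- (\<beta> + k) *\<^sub>R history x a c (\<beta> + k + 1) t = 0"
    by (rule vector_derivative_unique_at)
  then show ?case using \<open>\<beta> > 0\<close> by (auto simp: add_ac)
qed (use 0 in simp)

section \<open>Moments\<close>

text \<open>
  A function with vanishing moments is orthogonal to every polynomial, hence, approximating it
  by polynomials, to itself.
\<close>

lemma continuous_moments_zero_imp_zero: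
  fixes h :: "real \<Rightarrow> real"
  assumes h: "continuous_on {p..q} h" and "p < q"
    and mom: "\<And>k. integral {p..q} (\<lambda>u. h u * u ^ k) = 0"
    and "u \<in> {p..q}"
  shows "h u = 0"
proof -
  define A where "A = integral {p..q} (\<lambda>u. \<bar>h u\<bar>)"
  have A: "A \<ge> 0" unfolding A_def by (rule Henstock_Kurzweil_Integration.integral_nonneg)
      (auto intro!: integrable_continuous_interval continuous_intros h)
  have "integral {p..q} (\<lambda>u. h u * h u) \<le> e" if "e > 0" for e
  proof -
    have "e / (A + 1) > 0" using A that by simp
    then obtain g where g: "real_polynomial_function g"
      and close: "\<And>u. u \<in> {p..q} \<Longrightarrow> \<bar>h u - g u\<bar> < e / (A + 1)"
      using Stone_Weierstrass_real_polynomial_function[OF compact_Icc h] by metis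
    obtain w n where gw: "g = (\<lambda>u. \<Sum>i\<le>n. w i * u ^ i)"
      using g by (auto simp: real_polynomial_function_iff_sum)
    have cg: "continuous_on {p..q} g" unfolding gw by (intro continuous_intros)
    have "integral {p..q} (\<lambda>u. h u * g u) = integral {p..q} (\<lambda>u. \<Sum>i\<le>n. w i * (h u * u ^ i))"
      by (simp add: gw sum_distrib_left mult_ac)
    also have "\<dots> = (\<Sum>i\<le>n. integral {p..q} (\<lambda>u. w i * (h u * u ^ i)))"
      by (rule integral_sum) (auto intro!: integrable_continuous_interval continuous_intros h)
    also have "\<dots> = 0" by (simp add: mom)
    finally have hg: "integral {p..q} (\<lambda>u. h u * g u) = 0" .
    have "integral {p..q} (\<lambda>u. h u * h u)
        = integral {p..q} (\<lambda>u. h u * h u) - integral {p..q} (\<lambda>u. h u * g u)"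
      by (simp add: hg)
    also have "\<dots> = integral {p..q} (\<lambda>u. h u * h u - h u * g u)"
      by (rule Henstock_Kurzweil_Integration.integral_diff[symmetric])
        (auto intro!: integrable_continuous_interval continuous_intros h cg)
    also have "\<dots> \<le> integral {p..q} (\<lambda>u. e / (A + 1) * \<bar>h u\<bar>)"
    proof (rule integral_le)
      fix u assume u: "u \<in> {p..q}"
      have "h u * h u - h u * g u \<le> \<bar>h u\<bar> * \<bar>h u - g u\<bar>"
        by (simp flip: right_diff_distrib abs_mult)
      also have "\<dots> \<le> \<bar>h u\<bar> * (e / (A + 1))"
        using close[OF u] by (intro mult_left_mono) auto
      finally show "h u * h u - h u * g u \<le> e / (A + 1) * \<bar>h u\<bar>" by (simp add: mult_ac)
    qed (use A in \<open>auto intro!: integrable_continuous_interval continuous_intros h cg\<close>)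
    also have "\<dots> = e * (A / (A + 1))" by (simp add: A_def)
    also have "\<dots> \<le> e * 1" using A that by (intro mult_left_mono) auto
    finally show ?thesis by simp
  qed
  then have "integral {p..q} (\<lambda>u. h u * h u) \<le> 0" by (rule field_le_epsilon[of _ 0, simplified])
  moreover have "integral {p..q} (\<lambda>u. h u * h u) \<ge> 0"
    by (rule Henstock_Kurzweil_Integration.integral_nonneg)
      (auto intro!: integrable_continuous_interval continuous_intros h)
  ultimately have "integral {p..q} (\<lambda>u. h u * h u) = 0" by simp
  then have "\<forall>u\<in>{p..q}. h u * h u = 0"
    using \<open>p < q\<close> by (subst (asm) integral_eq_0_iff) (auto intro!: continuous_intros h)
  then show ?thesis using \<open>u \<in> {p..q}\<close> by auto
qed

text \<open>
  In the variable \<open>u = 1 / (t - s)\<close> the history integral of order \<open>\<gamma>\<close> is \<open>\<gamma>\<close> times the integral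
  of \<open>R u * u powr (\<gamma> - 1)\<close> over \<open>{0..1 / (t - c)}\<close>, where \<open>R\<close> is the extended function. Vanishing
  for all \<open>\<gamma> = \<beta> + k\<close> is therefore a moment condition.
\<close>

lemma history_vanishes_imp_zero:
  fixes r :: "real \<Rightarrow> real"
  assumes r: "continuous_on {a..c} r" and "a \<le> c" "c < t" "\<beta> > 0"
    and hist: "\<And>k. history r a c (\<beta> + real k) t = 0"
    and s: "s \<in> {a..c}"
  shows "r s = 0"
proof -
  \<comment> \<open>The points \<open>s = a\<close> and \<open>s = c\<close> in the new variable; \<open>u = 0\<close> corresponds to \<open>s = -\<infinity>\<close>.\<close>
  define p where "p = 1 / (t - a)"
  define q where "q = 1 / (t - c)"
  have pq: "0 < p" "p \<le> q" using assms by (auto simp: p_def q_def field_simps)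
  define R where "R u = (if u \<le> p then r a else r (t - 1 / u))" for u
  have R_cont: "continuous_on {0..q} R"
  proof -
    have "continuous_on ({0..p} \<union> {p..q}) R"
      unfolding R_def
    proof (rule continuous_on_If)
      show "continuous_on {p..q} (\<lambda>u. r (t - 1 / u))"
      proof (rule continuous_on_compose2[OF r])
        show "continuous_on {p..q} (\<lambda>u. t - 1 / u)"
          using pq by (auto intro!: continuous_intros)
        show "(\<lambda>u. t - 1 / u) ` {p..q} \<subseteq> {a..c}"
        proof safe
          fix u assume u: "u \<in> {p..q}"
          have "1 / u \<le> 1 / p" "1 / q \<le> 1 / u" using u pq by (auto intro!: divide_left_mono)
          then show "t - 1 / u \<in> {a..c}" by (auto simp: p_def q_def)
        qed
      qed
    qed (auto simp: p_def)
    moreover have "{0..p} \<union> {p..q} = {0..q}" using pq by auto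
    ultimately show ?thesis by simp
  qed
  \<comment> \<open>The weight \<open>u powr (\<beta> - 1)\<close> of the lowest order may be singular at 0. With one more power
    of \<open>u\<close> the function is continuous on the closed interval, at the price of using the orders
    \<open>\<beta> + 1, \<beta> + 2, \<dots>\<close> only.\<close>
  define h where "h u = R u * u powr \<beta>" for u
  have h_cont: "continuous_on {0..q} h"
    unfolding h_def using \<open>\<beta> > 0\<close> by (auto intro!: continuous_intros R_cont continuous_on_powr')
  have "integral {0..q} (\<lambda>u. h u * u ^ k) = 0" for k
  proof -
    define \<gamma> where "\<gamma> = \<beta> + real (Suc k)"
    have \<gamma>: "\<gamma> > 1" using \<open>\<beta> > 0\<close> by (simp add: \<gamma>_def)
    have hk: "h u * u ^ k = R u * u powr (\<gamma> - 1)" if "u \<ge> 0" for u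
      using that \<open>\<beta> > 0\<close> by (cases "u = 0") (auto simp: h_def \<gamma>_def powr_add powr_realpow)
    have cont: "continuous_on {0..q} (\<lambda>u. R u * u powr (\<gamma> - 1))"
      using \<gamma> by (auto intro!: continuous_intros R_cont continuous_on_powr')
    have left: "((\<lambda>u. R u * u powr (\<gamma> - 1)) has_integral (r a * (p powr \<gamma> / \<gamma>))) {0..p}"
    proof (rule has_integral_eq)
      show "((\<lambda>u. r a * u powr (\<gamma> - 1)) has_integral (r a * (p powr \<gamma> / \<gamma>))) {0..p}"
        using has_integral_powr_from_0[of "\<gamma> - 1" p] \<gamma> pq
        by (intro has_integral_mult_right) auto
    qed (simp add: R_def)
    have right: "((\<lambda>s. (1 / (t - s)\<^sup>2) *\<^sub>R (R (1 / (t - s)) * (1 / (t - s)) powr (\<gamma> - 1))) has_integral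
        integral {1 / (t - a)..1 / (t - c)} (\<lambda>u. R u * u powr (\<gamma> - 1))) {a..c}"
    proof (rule has_integral_substitution[where g = "\<lambda>s. 1 / (t - s)" and
          f = "\<lambda>u. R u * u powr (\<gamma> - 1)", OF _ _ _ cont])
      show "1 / (t - a) \<le> 1 / (t - c)" using pq by (simp add: p_def q_def)
      show "(\<lambda>s. 1 / (t - s)) ` {a..c} \<subseteq> {0..q}"
        using \<open>c < t\<close> by (auto simp: q_def intro!: divide_left_mono)
      show "((\<lambda>s. 1 / (t - s)) has_real_derivative 1 / (t - s)\<^sup>2) (at s within {a..c})"
        if "s \<in> {a..c}" for s
        using that \<open>c < t\<close> by (auto intro!: derivative_eq_intros simp: power2_eq_square)
    qed (use assms in auto)
    have eq: "(1 / (t - s)\<^sup>2) *\<^sub>R (R (1 / (t - s)) * (1 / (t - s)) powr (\<gamma> - 1))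
        = (t - s) powr (- \<gamma> - 1) *\<^sub>R r s" if "s \<in> {a..c}" for s
    proof -
      have ts: "t - s > 0" using that \<open>c < t\<close> by simp
      have "R (1 / (t - s)) = r s"
        using that ts \<open>c < t\<close> \<open>a \<le> c\<close> by (auto simp: R_def p_def field_simps)
      moreover have "1 / (t - s)\<^sup>2 * (1 / (t - s)) powr (\<gamma> - 1) = (t - s) powr (- \<gamma> - 1)"
      proof -
        have "(1 / (t - s)) powr (\<gamma> - 1) = (t - s) powr (1 - \<gamma>)"
          using powr_minus_divide[of "t - s" "\<gamma> - 1"] ts by (simp add: powr_divide)
        moreover have "1 / (t - s)\<^sup>2 = (t - s) powr (- 2)"
          using ts by (simp add: powr_minus_divide powr_numeral)
        moreover have "- \<gamma> - 1 = - 2 + (1 - \<gamma>)" by simp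
        ultimately show ?thesis by (simp only: powr_add)
      qed
      ultimately show ?thesis by (simp add: mult_ac)
    qed
    have right': "integral {p..q} (\<lambda>u. R u * u powr (\<gamma> - 1))
        = integral {a..c} (\<lambda>s. (t - s) powr (- \<gamma> - 1) *\<^sub>R r s)"
      using integral_unique[OF has_integral_eq[OF eq right]] by (simp add: p_def q_def)
    have "integral {0..q} (\<lambda>u. h u * u ^ k) = integral {0..q} (\<lambda>u. R u * u powr (\<gamma> - 1))"
      using hk by (intro Henstock_Kurzweil_Integration.integral_cong) auto
    also have "\<dots> = integral {0..p} (\<lambda>u. R u * u powr (\<gamma> - 1))
        + integral {p..q} (\<lambda>u. R u * u powr (\<gamma> - 1))"
      using pq by (intro Henstock_Kurzweil_Integration.integral_combine[symmetric]
          integrable_continuous_interval cont) auto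
    also have "\<dots> = r a * (p powr \<gamma> / \<gamma>) + integral {a..c} (\<lambda>s. (t - s) powr (- \<gamma> - 1) *\<^sub>R r s)"
      by (simp only: integral_unique[OF left] right')
    also have "p powr \<gamma> = (t - a) powr (- \<gamma>)"
      using \<open>a \<le> c\<close> \<open>c < t\<close> by (simp add: p_def powr_divide powr_minus_divide)
    also have "r a * ((t - a) powr (- \<gamma>) / \<gamma>) + integral {a..c} (\<lambda>s. (t - s) powr (- \<gamma> - 1) *\<^sub>R r s)
        = history r a c \<gamma> t / \<gamma>"
      unfolding history_def using \<gamma> by (simp add: add_divide_distrib)
    finally show ?thesis using hist[of "Suc k"] by (simp add: \<gamma>_def)
  qed
  then have "h (1 / (t - s)) = 0"
    using s pq \<open>c < t\<close> h_cont
    by (intro continuous_moments_zero_imp_zero[of 0 q h])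
      (auto simp: q_def intro!: divide_left_mono)
  moreover have "R (1 / (t - s)) = r s"
    using s \<open>c < t\<close> \<open>a \<le> c\<close> by (auto simp: R_def p_def field_simps)
  ultimately show ?thesis using s \<open>c < t\<close> by (simp add: h_def)
qed

section \<open>Null sets\<close>

lemma continuous_AE_zero_imp_zero:
  fixes f :: "real \<Rightarrow> 'a::real_normed_vector"
  assumes f: "continuous_on {c<..<d} f" and "AE t\<in>{c..d} in lebesgue. f t = 0" "t \<in> {c<..<d}"
  shows "f t = 0"
proof (rule ccontr)
  assume "f t \<noteq> 0"
  define U where "U = {c<..<d} \<inter> f -` (- {0})"
  obtain N where N: "negligible N" "{t. \<not> (t \<in> {c..d} \<longrightarrow> f t = 0)} \<subseteq> N"
    using assms(2) by (auto simp: eventually_ae_filter_negligible)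
  have "open U" unfolding U_def
    by (rule continuous_open_preimage[OF f]) auto
  moreover have "U \<subseteq> {t. \<not> (t \<in> {c..d} \<longrightarrow> f t = 0)}" by (auto simp: U_def)
  then have "negligible U" using N negligible_subset order.trans by metis
  moreover have "t \<in> U" using assms(3) \<open>f t \<noteq> 0\<close> by (auto simp: U_def)
  ultimately show False using open_not_negligible by blast
qed

section \<open>The kernel integral\<close>

lemma has_integral_kernel:
  fixes a t \<alpha> :: real
  assumes "a \<le> t" "\<alpha> < 1"
  shows "((\<lambda>s. (t - s) powr (- \<alpha>)) has_integral (t - a) powr (1 - \<alpha>) / (1 - \<alpha>)) {a..t}"
proof -
  have "((\<lambda>s. (t - s) powr (- \<alpha>)) has_integral
      (- ((t - t) powr (1 - \<alpha>) / (1 - \<alpha>)) - (- ((t - a) powr (1 - \<alpha>) / (1 - \<alpha>))))) {a..t}"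
  proof (rule fundamental_theorem_of_calculus_interior[OF \<open>a \<le> t\<close>])
    show "continuous_on {a..t} (\<lambda>s. - ((t - s) powr (1 - \<alpha>) / (1 - \<alpha>)))"
      using \<open>\<alpha> < 1\<close> by (auto intro!: continuous_intros continuous_on_powr')
    show "((\<lambda>s. - ((t - s) powr (1 - \<alpha>) / (1 - \<alpha>))) has_vector_derivative (t - s) powr (- \<alpha>)) (at s)"
      if "s \<in> {a<..<t}" for s
    proof -
      have "((\<lambda>s. (t - s) powr (1 - \<alpha>)) has_real_derivative - ((1 - \<alpha>) * (t - s) powr (- \<alpha>))) (at s)"
        using that by (auto intro!: derivative_eq_intros)
      from DERIV_minus[OF DERIV_cdivide[OF this, of "1 - \<alpha>"]] show ?thesis
        using \<open>\<alpha> < 1\<close> by (simp add: has_real_derivative_iff_has_vector_derivative)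
    qed
  qed
  then show ?thesis using \<open>\<alpha> < 1\<close> by simp
qed

text \<open>
  The kernel integral of \<open>x\<close> reduces to \<open>{a..c}\<close>, and that of the constant \<open>x a\<close> has a closed form.
  Together they are a history integral of order \<open>\<alpha> - 1\<close>.
\<close>

lemma RL_kernel_integral_eq_history:
  fixes x :: "real \<Rightarrow> 'a::euclidean_space"
  assumes x: "continuous_on {a..c} x" and "a \<le> c" and t: "t \<in> {c<..d}"
    and zero: "\<And>s. s \<in> {c..d} \<Longrightarrow> x s = 0" and "\<alpha> < 1"
  shows "RL_kernel_integral (1 - \<alpha>) a (\<lambda>s. x s - x a) t
      = (1 / ((\<alpha> - 1) * Gamma (1 - \<alpha>))) *\<^sub>R history x a c (\<alpha> - 1) t"
proof -
  define k where "k s = (t - s) powr (- \<alpha>)" for s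
  have k_int: "(k has_integral (t - a) powr (1 - \<alpha>) / (1 - \<alpha>)) {a..t}"
    unfolding k_def using assms by (intro has_integral_kernel) auto
  have k_abs: "k absolutely_integrable_on {a..t}"
    using k_int by (intro nonnegative_absolutely_integrable_1) (auto simp: k_def)
  have "(\<lambda>s. k s *\<^sub>R x a) absolutely_integrable_on {a..t}"
    using absolutely_integrable_linear[OF k_abs bounded_linear_scaleR_left[of "x a"]]
    by (simp add: o_def)
  moreover have int_const: "((\<lambda>s. k s *\<^sub>R x a) has_integral
      ((t - a) powr (1 - \<alpha>) / (1 - \<alpha>)) *\<^sub>R x a) {a..t}"
    by (rule has_integral_scaleR_left[OF k_int])
  moreover have "(\<lambda>s. k s *\<^sub>R x s) absolutely_integrable_on {a..c}"
    using t unfolding k_def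
    by (intro absolutely_integrable_continuous_real continuous_intros x) auto
  then have "(\<lambda>s. k s *\<^sub>R x s) absolutely_integrable_on {a..t}"
  proof (rule absolutely_integrable_spike_set)
    show "negligible {s \<in> {a..c} - {a..t}. k s *\<^sub>R x s \<noteq> 0}"
      using t by (intro negligible_subset[OF negligible_empty]) auto
    show "negligible {s \<in> {a..t} - {a..c}. k s *\<^sub>R x s \<noteq> 0}"
      using t zero by (intro negligible_subset[OF negligible_empty]) auto
  qed
  moreover have "integral {a..t} (\<lambda>s. k s *\<^sub>R x s) = integral {a..c} (\<lambda>s. k s *\<^sub>R x s)"
    by (rule integral_spike_set) (use t zero in \<open>auto intro!: negligible_subset[OF negligible_empty]\<close>)
  ultimately have diff: "(\<lambda>s. k s *\<^sub>R x s - k s *\<^sub>R x a) absolutely_integrable_on {a..t}"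
    and val: "integral {a..t} (\<lambda>s. k s *\<^sub>R x s - k s *\<^sub>R x a)
      = integral {a..c} (\<lambda>s. k s *\<^sub>R x s) - ((t - a) powr (1 - \<alpha>) / (1 - \<alpha>)) *\<^sub>R x a"
    by (auto simp: Henstock_Kurzweil_Integration.integral_diff set_lebesgue_integral_eq_integral(1)
        integral_unique intro: set_integral_diff(1))
  have "RL_kernel_integral (1 - \<alpha>) a (\<lambda>s. x s - x a) t
      = (LINT s:{a..t}|lebesgue. (1 / Gamma (1 - \<alpha>)) *\<^sub>R (k s *\<^sub>R x s - k s *\<^sub>R x a))"
    by (simp add: RL_kernel_integral_def k_def scaleR_diff_right)
  also have "\<dots> = (1 / Gamma (1 - \<alpha>)) *\<^sub>R (LINT s:{a..t}|lebesgue. k s *\<^sub>R x s - k s *\<^sub>R x a)"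
    by (rule set_integral_scaleR_right)
  also have "\<dots> = (1 / Gamma (1 - \<alpha>)) *\<^sub>R
      (integral {a..c} (\<lambda>s. k s *\<^sub>R x s) - ((t - a) powr (1 - \<alpha>) / (1 - \<alpha>)) *\<^sub>R x a)"
    by (simp only: set_lebesgue_integral_eq_integral(2)[OF diff] val)
  also have "\<dots> = (1 / ((\<alpha> - 1) * Gamma (1 - \<alpha>))) *\<^sub>R history x a c (\<alpha> - 1) t"
  proof -
    have "history x a c (\<alpha> - 1) t = (\<alpha> - 1) *\<^sub>R
        (integral {a..c} (\<lambda>s. k s *\<^sub>R x s) - ((t - a) powr (1 - \<alpha>) / (1 - \<alpha>)) *\<^sub>R x a)"
    proof -
      have "(\<alpha> - 1) * ((t - a) powr (1 - \<alpha>) / (1 - \<alpha>)) = - ((t - a) powr (1 - \<alpha>))"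
        using \<open>\<alpha> < 1\<close> by (simp add: field_simps)
      then have "(\<alpha> - 1) *\<^sub>R ((t - a) powr (1 - \<alpha>) / (1 - \<alpha>)) *\<^sub>R x a
          = - ((t - a) powr (1 - \<alpha>) *\<^sub>R x a)"
        by (simp only: scaleR_scaleR scaleR_minus_left)
      then show ?thesis by (simp only: history_def k_def scaleR_diff_right) simp
    qed
    then show ?thesis using \<open>\<alpha> < 1\<close> by simp
  qed
  finally show ?thesis .
qed

text \<open>
  A continuous representative agrees with the kernel integral only almost everywhere on
  \<open>{a..b}\<close>; where both are continuous they agree at every point.
\<close>

lemma RL_integral_eq_kernel_integral:
  fixes f :: "real \<Rightarrow> 'a::euclidean_space"
  assumes "a \<le> c" "d \<le> b"
    and cont: "continuous_on {c<..<d} (RL_kernel_integral \<gamma> a f)" and t: "t \<in> {c<..<d}"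
  shows "RL_integral \<gamma> a b f t = RL_kernel_integral \<gamma> a f t"
proof (cases "\<exists>g. is_cont_rep a b (RL_kernel_integral \<gamma> a f) g")
  case True
  then have "is_cont_rep a b (RL_kernel_integral \<gamma> a f) (RL_integral \<gamma> a b f)"
    unfolding RL_integral_def using someI_ex[OF True] by simp
  then have c: "continuous_on {a..b} (RL_integral \<gamma> a b f)"
    and ae: "AE t\<in>{a..b} in lebesgue. RL_integral \<gamma> a b f t = RL_kernel_integral \<gamma> a f t"
    by (auto simp: is_cont_rep_def)
  have "RL_integral \<gamma> a b f t - RL_kernel_integral \<gamma> a f t = 0"
  proof (rule continuous_AE_zero_imp_zero[OF _ _ t])
    show "continuous_on {c<..<d} (\<lambda>t. RL_integral \<gamma> a b f t - RL_kernel_integral \<gamma> a f t)"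
      using assms by (intro continuous_on_diff cont continuous_on_subset[OF c]) auto
    show "AE t\<in>{c..d} in lebesgue. RL_integral \<gamma> a b f t - RL_kernel_integral \<gamma> a f t = 0"
      using ae by eventually_elim (use assms in auto)
  qed
  then show ?thesis by simp
qed (simp add: RL_integral_def)

section \<open>Unique continuation\<close>

text \<open>
  The Riemann--Liouville integral is a multiple of the history integral of order \<open>\<alpha> - 1\<close> on
  \<open>{c<..<d}\<close>, and differentiating raises the order to \<open>\<alpha>\<close>. Hence it is differentiable at every
  point of this open interval, so that the value of the vector derivative is genuine.
\<close>

lemma Caputo_deriv_eq_history:
  fixes x :: "real \<Rightarrow> 'a::euclidean_space"
  assumes x: "continuous_on {a..c} x" and "a \<le> c" "d \<le> b" and t: "t \<in> {c<..<d}"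
    and zero: "\<And>s. s \<in> {c..d} \<Longrightarrow> x s = 0" and "\<alpha> < 1"
  shows "Caputo_deriv \<alpha> a b x t = (- 1 / Gamma (1 - \<alpha>)) *\<^sub>R history x a c \<alpha> t"
proof -
  define C where "C = 1 / ((\<alpha> - 1) * Gamma (1 - \<alpha>))"
  let ?f = "\<lambda>s. x s - x a"
  have K: "RL_kernel_integral (1 - \<alpha>) a ?f t = C *\<^sub>R history x a c (\<alpha> - 1) t"
    if "t \<in> {c<..<d}" for t
    unfolding C_def using that assms by (intro RL_kernel_integral_eq_history[where d = d]) auto
  have "continuous_on {c<..<d} (\<lambda>t. C *\<^sub>R history x a c (\<alpha> - 1) t)"
    by (intro continuous_intros continuous_on_subset[OF continuous_on_history[OF x \<open>a \<le> c\<close>]]) auto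
  then have "continuous_on {c<..<d} (RL_kernel_integral (1 - \<alpha>) a ?f)"
    by (rule continuous_on_eq) (simp add: K)
  then have F: "RL_integral (1 - \<alpha>) a b ?f t = C *\<^sub>R history x a c (\<alpha> - 1) t"
    if "t \<in> {c<..<d}" for t
    using RL_integral_eq_kernel_integral[OF \<open>a \<le> c\<close> \<open>d \<le> b\<close>, of "1 - \<alpha>" ?f t] K[OF that] that
    by simp
  have "((\<lambda>t. C *\<^sub>R history x a c (\<alpha> - 1) t) has_vector_derivative
      C *\<^sub>R - (\<alpha> - 1) *\<^sub>R history x a c (\<alpha> - 1 + 1) t) (at t)"
    using t by (intro bounded_linear.has_vector_derivative[OF bounded_linear_scaleR_right]
        has_vector_derivative_history x \<open>a \<le> c\<close>) auto
  then have "(RL_integral (1 - \<alpha>) a b ?f has_vector_derivative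
      C *\<^sub>R - (\<alpha> - 1) *\<^sub>R history x a c (\<alpha> - 1 + 1) t) (at t)"
    by (rule has_vector_derivative_transform_within_open[of _ _ _ "{c<..<d}"]) (use t F in auto)
  then have "Caputo_deriv \<alpha> a b x t = C *\<^sub>R - (\<alpha> - 1) *\<^sub>R history x a c (\<alpha> - 1 + 1) t"
    unfolding Caputo_deriv_def RL_deriv_def
    by (rule vector_derivative_at_within_ivl) (use assms in auto)
  moreover have "C * - (\<alpha> - 1) = - 1 / Gamma (1 - \<alpha>)"
    using \<open>\<alpha> < 1\<close> by (simp add: C_def divide_simps)
  ultimately show ?thesis by (simp only: scaleR_scaleR) simp
qed

lemma history_inner:
  fixes x :: "real \<Rightarrow> 'a::euclidean_space"
  assumes x: "continuous_on {a..c} x" and "c < t"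
  shows "history (\<lambda>s. x s \<bullet> e) a c \<beta> t = history x a c \<beta> t \<bullet> e"
proof -
  have "(\<lambda>s. (t - s) powr (- \<beta> - 1) *\<^sub>R x s) integrable_on {a..c}"
    using \<open>c < t\<close> by (intro integrable_continuous_interval continuous_intros x) auto
  from integral_linear[OF this bounded_linear_inner_left[of e]]
  show ?thesis by (simp add: history_def o_def inner_add_left)
qed

theorem proposition3p3:
  fixes a b c d \<alpha> :: real and x :: "real \<Rightarrow> real ^ 'n"
  assumes "a < b"
    and "0 < \<alpha>" "\<alpha> < 1"
    and "x \<in> Caputo_AC \<alpha> a b"
    and "a \<le> c" "c < d" "d \<le> b"
    and "\<forall>t\<in>{c..d}. x t = 0"
    and "AE t\<in>{c..d} in lebesgue. Caputo_deriv \<alpha> a b x t = 0"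
  shows "\<forall>t\<in>{a..d}. x t = 0"
proof -
  have "continuous_on {a..b} x" using assms by (simp add: Caputo_AC_def)
  then have x: "continuous_on {a..c} x" by (rule continuous_on_subset) (use assms in auto)
  have "Gamma (1 - \<alpha>) \<noteq> 0" using assms by (intro less_imp_neq[symmetric] Gamma_real_pos) auto
  then have iff: "Caputo_deriv \<alpha> a b x t = 0 \<longleftrightarrow> history x a c \<alpha> t = 0" if "t \<in> {c<..<d}" for t
    using Caputo_deriv_eq_history[of a c x d b t \<alpha>] assms x that by auto
  \<comment> \<open>At the end points \<open>c\<close> and \<open>d\<close> the formula for the Caputo derivative may fail.\<close>
  have ae: "AE t\<in>{c..d} in lebesgue. history x a c \<alpha> t = 0"
  proof -
    have "AE t in lebesgue. t \<notin> {c, d}"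
      by (rule AE_I'[of "{c, d}"]) (auto simp: negligible_iff_null_sets[symmetric])
    with assms(9) show ?thesis by eventually_elim (use iff in force)
  qed
  have "history x a c \<alpha> t = 0" if "t \<in> {c<..<d}" for t
    by (rule continuous_AE_zero_imp_zero[OF _ ae that])
      (auto intro: continuous_on_subset[OF continuous_on_history[OF x \<open>a \<le> c\<close>]])
  \<comment> \<open>Any point of \<open>{c<..<d}\<close> serves as the base point of the moment argument.\<close>
  then have "history x a c (\<alpha> + real k) ((c + d) / 2) = 0" for k
    using assms by (intro history_vanishes_higher_order[where d = d] x) auto
  then have "x s \<bullet> e = 0" if "s \<in> {a..c}" for s e
    using assms that history_inner[OF x, of "(c + d) / 2" e]
    by (intro history_vanishes_imp_zero[of a c "\<lambda>s. x s \<bullet> e" "(c + d) / 2" \<alpha>])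
      (auto intro!: continuous_intros x)
  then have "x s = 0" if "s \<in> {a..c}" for s
    using that by (metis inner_eq_zero_iff)
  then show ?thesis using assms(8) by (metis atLeastAtMost_iff linear)
qed

end
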